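(* Let $A$ be a unitarily irreducible $3$-by-$3$ complex matrix. Then the multi-valued map $f_A^{-1}\colon F(A) \to \mathbb{C}\mathbb{P}^{2}$ is strongly continuous on $F(A)$ (that is, at every point of $F(A)$).
   Context: A matrix $A \in M_n(\mathbb{C})$ is unitarily reducible if and only if there exists a unitary matrix $U$ such that $U^*AU$ is the direct sum of two smaller (square) matrices; otherwise it is unitarily irreducible. For $A \in M_n(\mathbb{C})$ the field of values is $F(A) = \{x^*Ax : x \in \mathbb{C}^n,\ x^*x = 1\} \subset \mathbb{C}$. Let $\mathbb{C}\mathbb{P}^{n-1}$ be the quotient of the unit sphere $\{x \in \mathbb{C}^n : x^*x=1\}$ by multiplication by unimodular scalars, with a metric inducing the quotient topology. Since $(\omega x)^*A(\omega x) = x^*Ax$ for $|\omega|=1$, the map $f_A(x) = x^*Ax$ (with $x$ a unit representative) is a well-defined map $\mathbb{C}\mathbb{P}^{n-1} \to F(A)$, and $f_A^{-1}$ is the multi-valued map sending $z \in F(A)$ to its preimage $f_A^{-1}(z) = \{x \in \mathbb{C}\mathbb{P}^{n-1} : f_A(x) = z\}$. A multi-valued function $g$ from a metric space $(X,d)$ to a metric space $(Y,\rho)$ is strongly continuous at $x \in X$ if for all $y \in g(x)$: for every $\epsilon>0$ there is $\delta>0$ such that for every $x' \in X$ with $d(x,x')<\delta$ there exists $y' \in g(x')$ with $\rho(y,y')<\epsilon$. Here $X = F(A)$ with the usual metric of $\mathbb{C}$. *)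

theory Defs
  imports "HOL-Analysis.Analysis"
begin

section \<open>Unitary reducibility\<close>

definition conj_transpose :: "complex^'n^'m \<Rightarrow> complex^'m^'n" where
  "conj_transpose A = (\<chi> i j. cnj (A $ j $ i))"

definition unitary_matrix :: "complex^'n^'n \<Rightarrow> bool" where
  "unitary_matrix U \<longleftrightarrow> conj_transpose U ** U = mat 1 \<and> U ** conj_transpose U = mat 1"

text \<open>
  A matrix is the direct sum of two smaller square matrices if it is block diagonal: the
  rows and columns with index below some cut \<open>k\<close> form the first block, the remaining ones the
  second. Both blocks are nonempty, since some index lies below \<open>k\<close> and \<open>k\<close> itself lies in the
  second block. For a numeral index type such as \<^typ>\<open>3\<close> the order is the usual one, \<open>0 < 1 < 2\<close>.
\<close>

definition is_direct_sum :: "complex^('n::{finite,linorder})^('n::{finite,linorder}) \<Rightarrow> bool" where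
  "is_direct_sum B \<longleftrightarrow>
     (\<exists>k. (\<exists>i. i < k) \<and>
          (\<forall>i j. i < k \<longrightarrow> k \<le> j \<longrightarrow> B $ i $ j = 0 \<and> B $ j $ i = 0))"

definition unitarily_reducible :: "complex^('n::{finite,linorder})^('n::{finite,linorder}) \<Rightarrow> bool" where
  "unitarily_reducible A \<longleftrightarrow>
     (\<exists>U. unitary_matrix U \<and> is_direct_sum (conj_transpose U ** A ** U))"

abbreviation unitarily_irreducible :: "complex^('n::{finite,linorder})^('n::{finite,linorder}) \<Rightarrow> bool" where
  "unitarily_irreducible A \<equiv> \<not> unitarily_reducible A"


section \<open>The field of values\<close>

text \<open>\<open>herm x y\<close> is \<open>x\<^sup>* y\<close>; the library's \<^const>\<open>inner\<close> on complex vectors is its real part.\<close>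

definition herm :: "complex^'n \<Rightarrow> complex^'n \<Rightarrow> complex" where
  "herm x y = (\<Sum>i\<in>UNIV. cnj (x $ i) * y $ i)"

definition unit_sphere :: "(complex^'n) set" where
  "unit_sphere = {x. herm x x = 1}"

definition field_of_values :: "complex^'n^'n \<Rightarrow> complex set" where
  "field_of_values A = {herm x (A *v x) | x. x \<in> unit_sphere}"


section \<open>Complex projective space\<close>

definition phase_rel :: "((complex^'n) \<times> (complex^'n)) set" where
  "phase_rel = {(x, y). x \<in> unit_sphere \<and> y \<in> unit_sphere \<and> (\<exists>\<omega>. norm \<omega> = 1 \<and> y = \<omega> *s x)}"

text \<open>For index type \<open>'n\<close> of size \<open>n\<close> this is the projective space of complex dimension \<open>n - 1\<close>.\<close>

definition proj_space :: "(complex^'n) set set" where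
  "proj_space = unit_sphere // phase_rel"

definition proj_class :: "complex^'n \<Rightarrow> (complex^'n) set" where
  "proj_class x = phase_rel `` {x}"

text \<open>
  A metric on projective space whose topology is the quotient topology of the sphere. Such
  metrics exist, as shown at the end.
\<close>

definition proj_metric :: "((complex^'n) set \<Rightarrow> (complex^'n) set \<Rightarrow> real) \<Rightarrow> bool" where
  "proj_metric \<rho> \<longleftrightarrow>
     Metric_space proj_space \<rho> \<and>
     quotient_map (top_of_set unit_sphere) (Metric_space.mtopology proj_space \<rho>) proj_class"

definition fov_map :: "complex^'n^'n \<Rightarrow> (complex^'n) set \<Rightarrow> complex" where
  "fov_map A p = (THE z. \<exists>x\<in>p. z = herm x (A *v x))"

definition fov_inv :: "complex^'n^'n \<Rightarrow> complex \<Rightarrow> (complex^'n) set set" where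
  "fov_inv A z = {p \<in> proj_space. fov_map A p = z}"


section \<open>Strong continuity of multi-valued maps\<close>

definition strongly_continuous_at ::
  "'a set \<Rightarrow> ('a \<Rightarrow> 'a \<Rightarrow> real) \<Rightarrow> ('b \<Rightarrow> 'b \<Rightarrow> real) \<Rightarrow> ('a \<Rightarrow> 'b set) \<Rightarrow> 'a \<Rightarrow> bool" where
  "strongly_continuous_at X d \<rho> g x \<longleftrightarrow>
     (\<forall>y\<in>g x. \<forall>\<epsilon>>0. \<exists>\<delta>>0. \<forall>x'\<in>X. d x x' < \<delta> \<longrightarrow> (\<exists>y'\<in>g x'. \<rho> y y' < \<epsilon>))"


section \<open>Well-definedness\<close>

lemma herm_self: "herm x x = complex_of_real ((norm x)\<^sup>2)"
proof -
  have "herm x x = (\<Sum>i\<in>UNIV. complex_of_real ((norm (x $ i))\<^sup>2))"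
    unfolding herm_def complex_norm_square by (intro sum.cong refl mult.commute)
  also have "\<dots> = complex_of_real ((norm x)\<^sup>2)"
    by (simp add: norm_vec_def L2_set_def sum_nonneg)
  finally show ?thesis .
qed

lemma unit_sphere_eq: "unit_sphere = sphere 0 1"
proof -
  have "herm x x = 1 \<longleftrightarrow> norm x = 1" for x :: "complex^'n"
    unfolding herm_self of_real_eq_1_iff abs_square_eq_1
    by (simp only: abs_norm_cancel)
  then show ?thesis unfolding unit_sphere_def sphere_def dist_0_norm by (rule Collect_cong)
qed

lemma herm_scale: "herm (a *s x) (b *s y) = cnj a * b * herm x y"
  by (simp add: herm_def sum_distrib_left algebra_simps)

lemma equiv_phase_rel: "equiv unit_sphere phase_rel"
proof (rule equivI)
  show "refl_on unit_sphere phase_rel"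
    by (auto simp: refl_on_def phase_rel_def intro!: exI[of _ 1])
  show "sym phase_rel"
  proof (rule symI)
    fix x y :: "complex^'n" assume "(x, y) \<in> phase_rel"
    then obtain w where w: "x \<in> unit_sphere" "y \<in> unit_sphere" "norm w = 1" "y = w *s x"
      by (auto simp: phase_rel_def)
    have "w \<noteq> 0" using w by auto
    then have "x = inverse w *s y" using w by (simp add: vec_eq_iff)
    then show "(y, x) \<in> phase_rel"
      using w by (auto simp: phase_rel_def norm_inverse intro!: exI[of _ "inverse w"])
  qed
  show "trans phase_rel"
  proof (rule transI)
    fix x y z :: "complex^'n" assume "(x, y) \<in> phase_rel" "(y, z) \<in> phase_rel"
    then obtain v w where "x \<in> unit_sphere" "z \<in> unit_sphere" "norm v = 1" "norm w = 1"
      "z = (w * v) *s x"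
      by (auto simp: phase_rel_def vector_smult_assoc)
    then show "(x, z) \<in> phase_rel"
      by (auto simp: phase_rel_def norm_mult intro!: exI[of _ "w * v"])
  qed
qed (auto simp: phase_rel_def)

lemma proj_class_eq_iff:
  "x \<in> unit_sphere \<Longrightarrow> y \<in> unit_sphere \<Longrightarrow> proj_class x = proj_class y \<longleftrightarrow> (x, y) \<in> phase_rel"
  unfolding proj_class_def by (rule eq_equiv_class_iff[OF equiv_phase_rel])

lemma proj_space_eq: "proj_space = proj_class ` unit_sphere"
  by (auto simp: proj_space_def proj_class_def quotient_def)

lemma fov_map_proj_class:
  assumes "x \<in> unit_sphere"
  shows "fov_map A (proj_class x) = herm x (A *v x)"
  unfolding fov_map_def
proof (rule the_equality)
  have "x \<in> proj_class x"
    unfolding proj_class_def using equiv_class_self[OF equiv_phase_rel assms] .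
  then show "\<exists>y\<in>proj_class x. herm x (A *v x) = herm y (A *v y)" by blast
next
  fix z assume "\<exists>y\<in>proj_class x. z = herm y (A *v y)"
  then obtain w where w: "norm w = 1" "z = herm (w *s x) (A *v (w *s x))"
    by (auto simp: proj_class_def phase_rel_def)
  have "cnj w * w = 1"
    using complex_norm_square[of w] w(1) by (simp only: mult.commute[of w "cnj w"] one_power2 of_real_1)
  then show "z = herm x (A *v x)"
    using w(2) by (simp add: vector_scalar_commute herm_scale)
qed

definition rank_one :: "complex^'n \<Rightarrow> complex^'n^'n" where
  "rank_one x = (\<chi> i j. x $ i * cnj (x $ j))"

lemma rank_one_eq_iff:
  assumes x: "x \<in> unit_sphere" and y: "y \<in> unit_sphere"
  shows "rank_one x = rank_one y \<longleftrightarrow> (x, y) \<in> phase_rel"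
proof
  assume eq: "rank_one x = rank_one y"
  have r: "rank_one u *v v = herm u v *s u" for u v :: "complex^'n"
    by (simp add: vec_eq_iff rank_one_def matrix_vector_mult_def herm_def sum_distrib_left
        sum_distrib_right algebra_simps)
  have "y = rank_one y *v y" unfolding r using y by (simp add: unit_sphere_def)
  also have "\<dots> = herm x y *s x" unfolding eq[symmetric] by (rule r)
  finally obtain c where c: "y = c *s x" by (rule that)
  have "herm y y = cnj c * c * herm x x"
    unfolding c by (rule herm_scale)
  moreover have "herm x x = 1" "herm y y = 1" using x y by (simp_all add: unit_sphere_def)
  ultimately have "complex_of_real ((norm c)\<^sup>2) = 1"
    by (simp only: complex_norm_square mult_1_right mult.commute[of c "cnj c"])
  then have "(norm c)\<^sup>2 = 1" using of_real_eq_1_iff by blast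
  then have "norm c = 1" unfolding abs_square_eq_1 by (simp only: abs_norm_cancel)
  then show "(x, y) \<in> phase_rel" using x y c by (auto simp: phase_rel_def)
next
  assume "(x, y) \<in> phase_rel"
  then obtain w where w: "norm w = 1" "y = w *s x" by (auto simp: phase_rel_def)
  have "w * cnj w = 1"
    using complex_norm_square[of w] w(1) by (simp only: one_power2 of_real_1)
  have "w * a * (cnj w * b) = a * b" for a b
  proof -
    have "w * a * (cnj w * b) = (w * cnj w) * (a * b)" by (simp only: mult_ac)
    then show ?thesis using \<open>w * cnj w = 1\<close> by simp
  qed
  then show "rank_one x = rank_one y" by (simp add: vec_eq_iff rank_one_def w(2))
qed

lemma proj_metric_exists: "\<exists>\<rho>. proj_metric (\<rho> :: (complex^'n) set \<Rightarrow> (complex^'n) set \<Rightarrow> real)"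
proof -
  define g :: "(complex^'n) set \<Rightarrow> complex^'n^'n" where "g p = rank_one (SOME x. x \<in> p)" for p
  define \<rho> where "\<rho> p q = dist (g p) (g q)" for p q
  have g: "g (proj_class x) = rank_one x" if x: "x \<in> unit_sphere" for x
  proof -
    have "x \<in> proj_class x"
      unfolding proj_class_def using equiv_class_self[OF equiv_phase_rel x] .
    then have "(SOME y. y \<in> proj_class x) \<in> proj_class x" by (rule someI)
    then have *: "(x, SOME y. y \<in> proj_class x) \<in> phase_rel" by (simp add: proj_class_def)
    then have "(SOME y. y \<in> proj_class x) \<in> unit_sphere" by (auto simp: phase_rel_def)
    then have "rank_one x = rank_one (SOME y. y \<in> proj_class x)"
      using rank_one_eq_iff[OF x] * by blast
    then show ?thesis unfolding g_def by (rule sym)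
  qed
  have inj: "inj_on g proj_space"
    by (auto simp: inj_on_def proj_space_eq g rank_one_eq_iff proj_class_eq_iff)
  interpret M: Metric_space proj_space \<rho>
    by unfold_locales
      (auto simp: \<rho>_def dist_commute dist_triangle inj_on_eq_iff[OF inj])
  have cont: "continuous_map (top_of_set unit_sphere) M.mtopology proj_class"
    unfolding M.continuous_map_to_metric
  proof (intro ballI allI impI)
    fix x :: "complex^'n" and e :: real
    assume "x \<in> topspace (top_of_set unit_sphere)" and e: "0 < e"
    then have x: "x \<in> unit_sphere" by simp
    have "continuous_on UNIV (rank_one :: complex^'n \<Rightarrow> _)"
      unfolding rank_one_def by (intro continuous_intros)
    then have "open {y :: complex^'n. dist (rank_one x) (rank_one y) < e}"
      by (intro open_Collect_less continuous_intros) auto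
    then have "openin (top_of_set unit_sphere)
        (unit_sphere \<inter> {y. dist (rank_one x) (rank_one y) < e})"
      by (rule openin_open_Int)
    moreover have "proj_class y \<in> M.mball (proj_class x) e"
      if "y \<in> unit_sphere" "dist (rank_one x) (rank_one y) < e" for y
      using x that unfolding M.in_mball \<rho>_def by (simp add: g) (simp add: proj_space_eq)
    ultimately show "\<exists>U. openin (top_of_set unit_sphere) U \<and> x \<in> U \<and>
        (\<forall>y\<in>U. proj_class y \<in> M.mball (proj_class x) e)"
      using x e
      by (intro exI[of _ "unit_sphere \<inter> {y. dist (rank_one x) (rank_one y) < e}"])
        auto
  qed
  have "quotient_map (top_of_set unit_sphere) M.mtopology proj_class"
  proof (rule continuous_closed_imp_quotient_map[OF cont])
    show "closed_map (top_of_set unit_sphere) M.mtopology proj_class"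
      by (rule T1_Spaces.continuous_imp_closed_map[OF cont _ M.Hausdorff_space_mtopology])
        (simp add: unit_sphere_eq compact_space_subtopology)
    show "proj_class ` topspace (top_of_set unit_sphere) = topspace M.mtopology"
      by (simp flip: proj_space_eq)
  qed
  then have "proj_metric \<rho>" unfolding proj_metric_def using M.Metric_space_axioms by blast
  then show ?thesis by blast
qed

end

theory Submission
  imports Defs
begin

text \<open>
  The claim amounts to openness of the numerical map \<open>x \<mapsto> x\<^sup>*Ax\<close>, from the sphere onto the field
  of values, at every unit vector \<open>x\<^sub>0\<close>. Let \<open>z\<^sub>0\<close> be its value there. If its derivative at \<open>x\<^sub>0\<close> is
  onto, this is an open mapping theorem. Otherwise, after a rotation, \<open>A - z\<^sub>0\<close> becomes
  \<open>(K + iH) / 2\<close> with self-adjoint \<open>K\<close>, \<open>H\<close> and \<open>K x\<^sub>0 = 0\<close>, and \<open>H x\<^sub>0 \<noteq> 0\<close> by irreducibility.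
  For \<open>y\<close> orthogonal to \<open>x\<^sub>0\<close>, the value of \<open>K\<close> at \<open>(1 - |y|\<^sup>2)\<^sup>1\<^sup>/\<^sup>2 x\<^sub>0 + \<phi>y\<close> is \<open>y\<^sup>*Ky\<close> for every phase
  \<open>\<phi>\<close>, while that of \<open>H\<close> changes to first order in \<open>|y|\<close> with \<open>\<phi>\<close> if \<open>y\<^sup>*Hx\<^sub>0 \<noteq> 0\<close>. So it
  suffices to join two such vectors \<open>y\<close> for which the values of \<open>K\<close> have opposite signs (or are
  zero, on a side to which \<open>K\<close> takes no values) without leaving the region \<open>y\<^sup>*Hx\<^sub>0 \<noteq> 0\<close>. If \<open>K\<close>
  is semidefinite, one end of the path comes from a second preimage of \<open>z\<^sub>0\<close>, and this is the place
  where the dimension is used; if there is no second preimage, compactness suffices.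
\<close>

section \<open>Algebra and continuity of the Hermitian form\<close>

lemma herm_commute: "herm y x = cnj (herm x y)"
  by (simp add: herm_def mult.commute)

lemma herm_add_left: "herm (x + y) z = herm x z + herm y z"
  by (simp add: herm_def sum.distrib algebra_simps)

lemma herm_add_right: "herm x (y + z) = herm x y + herm x z"
  by (simp add: herm_def sum.distrib algebra_simps)

lemma herm_diff_left: "herm (x - y) z = herm x z - herm y z"
  by (simp add: herm_def sum_subtractf algebra_simps)

lemma herm_diff_right: "herm x (y - z) = herm x y - herm x z"
  by (simp add: herm_def sum_subtractf algebra_simps)

lemma herm_smult_left: "herm (a *s x) y = cnj a * herm x y"
  by (simp add: herm_def sum_distrib_left algebra_simps)

lemma herm_smult_right: "herm x (a *s y) = a * herm x y"
  by (simp add: herm_def sum_distrib_left algebra_simps)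

lemma herm_uminus: "herm (- x) y = - herm x y" "herm x (- y) = - herm x y"
  by (simp_all add: herm_def sum_negf)

lemma herm_zero [simp]: "herm 0 x = 0" "herm x 0 = 0"
  by (simp_all add: herm_def)

lemmas herm_linear = herm_add_left herm_add_right herm_diff_left herm_diff_right
  herm_smult_left herm_smult_right

lemma herm_self_eq_0_iff [simp]: "herm x x = 0 \<longleftrightarrow> x = 0"
  by (simp add: herm_self)

lemma norm_smult: "norm (c *s x) = norm c * norm (x :: complex^'n)"
proof -
  have "complex_of_real ((norm (c *s x))\<^sup>2) = complex_of_real ((norm c * norm x)\<^sup>2)"
    unfolding herm_self[symmetric] herm_linear
    by (simp add: herm_self power_mult_distrib complex_norm_square mult_ac
        flip: mult.assoc of_real_power)
  then have "(norm (c *s x))\<^sup>2 = (norm c * norm x)\<^sup>2"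
    using of_real_eq_iff by blast
  then show ?thesis by (simp add: power2_eq_iff_nonneg)
qed

lemma scaleR_eq_smult: "r *\<^sub>R x = complex_of_real r *s (x :: complex^'n)"
  by (simp add: vec_eq_iff scaleR_conv_of_real[where 'a = complex])

text \<open>Conjugate-linearity is still linearity over the reals, so continuity and the product
  rule for bounded bilinear maps become available for \<open>herm\<close>.\<close>

lemma bounded_bilinear_herm: "bounded_bilinear (herm :: complex^'n \<Rightarrow> complex^'n \<Rightarrow> complex)"
proof -
  have "bilinear (herm :: complex^'n \<Rightarrow> complex^'n \<Rightarrow> complex)"
    unfolding bilinear_def
    by (auto intro!: linearI simp: herm_linear scaleR_eq_smult scaleR_conv_of_real)
  then show ?thesis by (simp add: bilinear_conv_bounded_bilinear)
qed

lemma bounded_linear_matrix_complex: "bounded_linear (\<lambda>x. (M :: complex^'n^'m) *v x)"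
proof -
  have "linear (\<lambda>x. M *v x)"
    by (intro linearI) (simp_all add: matrix_vector_right_distrib scaleR_eq_smult vector_scalar_commute)
  then show ?thesis by (simp add: linear_conv_bounded_linear)
qed

lemmas continuous_on_herm [continuous_intros] =
  bounded_bilinear.continuous_on[OF bounded_bilinear_herm]
lemmas continuous_on_matrix_complex [continuous_intros] =
  bounded_linear.continuous_on[OF bounded_linear_matrix_complex]

lemma herm_conj_transpose: "herm x (M *v y) = herm (conj_transpose M *v x) y"
proof -
  have "herm x (M *v y) = (\<Sum>i\<in>UNIV. \<Sum>j\<in>UNIV. cnj (x $ i) * (M $ i $ j * y $ j))"
    by (simp add: herm_def matrix_vector_mult_def sum_distrib_left)
  also have "\<dots> = (\<Sum>j\<in>UNIV. \<Sum>i\<in>UNIV. cnj (x $ i) * (M $ i $ j * y $ j))"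
    by (rule sum.swap)
  also have "\<dots> = herm (conj_transpose M *v x) y"
    by (simp add: herm_def conj_transpose_def matrix_vector_mult_def sum_distrib_left sum_distrib_right mult_ac)
  finally show ?thesis .
qed

lemma conj_transpose_conj_transpose [simp]: "conj_transpose (conj_transpose M) = M"
  by (simp add: conj_transpose_def vec_eq_iff)

lemma herm_conj_transpose_swap: "herm x (conj_transpose M *v y) = cnj (herm y (M *v x))"
  by (subst herm_conj_transpose) (simp add: herm_commute[of _ y])

lemma mat_complex_mult_vec: "mat c *v x = c *s (x :: complex^'n)"
  by (simp add: vec_eq_iff matrix_vector_mult_def mat_def if_distrib[of "\<lambda>a. a * _"] cong: if_cong)

section \<open>Phases, reducing eigenvectors and orthogonal families\<close>

lemma unit_phase_to_nonneg:
  obtains \<phi> :: complex where "norm \<phi> = 1" "cnj \<phi> * c = of_real (norm c)"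
proof (cases "c = 0")
  case True
  then show ?thesis using that[of 1] by simp
next
  case False
  have "cnj (sgn c) * c = of_real (norm c)"
    using False complex_norm_square[of c]
    by (simp add: sgn_div_norm scaleR_conv_of_real field_simps power2_eq_square)
  then show ?thesis using that[of "sgn c"] False by (simp add: norm_sgn)
qed

text \<open>\<open>U\<close> is the Householder reflection exchanging \<open>w\<close> and the \<open>i\<close>-th basis vector; it exists
  because their inner product is real.\<close>

lemma unitary_self_adjoint_with_column:
  fixes w :: "complex^'n"
  assumes w: "herm w w = 1" and wi: "w $ i \<in> \<real>"
  obtains U where "conj_transpose U = U" "U ** U = mat 1" "U *v axis i 1 = w"
proof -
  define e :: "complex^'n" where "e = axis i 1"
  have he: "herm x e = cnj (x $ i)" for x
    by (simp add: herm_def e_def axis_def if_distrib[of "\<lambda>a. _ * a"] cong: if_cong)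
  have ei: "e $ i = 1" by (simp add: e_def)
  show ?thesis
  proof (cases "w = e")
    case True
    show ?thesis
      by (rule that[of "mat 1"])
        (use True in \<open>auto simp: e_def conj_transpose_def mat_def vec_eq_iff matrix_matrix_mult_def
            matrix_vector_mult_def axis_def if_distrib[of "\<lambda>a. a * _"] cong: if_cong\<close>)
  next
    case False
    define u where "u = w - e"
    have wi': "cnj (w $ i) = w $ i" using wi by (simp add: Reals_cnj_iff)
    have hew: "herm e w = w $ i" using he[of w] herm_commute[of e w] by simp
    have uu: "herm u u = 2 - 2 * w $ i"
      by (simp add: u_def herm_linear w he hew ei wi')
    have uu0: "herm u u \<noteq> 0" using False by (simp add: u_def)
    have ue: "herm u e = w $ i - 1" by (simp add: u_def herm_linear he ei wi')
    define c where "c = 2 / herm u u"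
    have cc: "cnj c = c" using uu wi' by (simp add: c_def)
    define U :: "complex^'n^'n" where "U = (\<chi> a b. (if a = b then 1 else 0) - c * u $ a * cnj (u $ b))"
    have Uv: "U *v x = x - (c * herm u x) *s u" for x
      by (simp add: vec_eq_iff U_def matrix_vector_mult_def herm_def left_diff_distrib
          right_diff_distrib sum_subtractf sum_distrib_left sum_distrib_right mult_ac if_distrib[of "\<lambda>a. _ * a"]
          cong: if_cong)
    have "c * herm u u = 2" using uu0 by (simp add: c_def)
    then have 2: "U *v u = - u" by (simp add: Uv vec_eq_iff)
    show ?thesis
    proof (rule that)
      show "conj_transpose U = U"
        by (auto simp: vec_eq_iff conj_transpose_def U_def cc)
      have "U *v (U *v x) = x" for x
        unfolding Uv[of x] by (simp add: matrix_vector_mult_diff_distrib vector_scalar_commute 2)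
          (simp add: Uv)
      then show "U ** U = mat 1"
        by (simp add: matrix_eq matrix_vector_mul_assoc)
      \<comment> \<open>As \<open>w $ i\<close> is real, \<open>herm u u\<close> is minus twice
        \<open>herm u e\<close>; hence the reflection sends \<open>e\<close> to
        \<open>e + u\<close>, which is \<open>w\<close>.\<close>
      have "c * herm u e = - 1" using uu0 unfolding ue c_def uu by (simp add: field_simps)
      then show "U *v axis i 1 = w"
        unfolding e_def[symmetric] Uv by (simp add: u_def)
    qed
  qed
qed

text \<open>The line through \<open>w\<close> is invariant under \<open>A\<close> and its adjoint,
  hence so is its orthogonal complement. A unitary matrix with a multiple of \<open>w\<close> as one
  column splits off a 1-by-1 block.\<close>

lemma unitarily_reducible_if_common_eigenvector:
  fixes A :: "complex^('n::{finite,linorder})^('n::{finite,linorder})"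
  assumes card: "CARD('n) > 1" and w0: "w \<noteq> 0"
    and Aw: "A *v w = a *s w" and A'w: "conj_transpose A *v w = b *s w"
  shows "unitarily_reducible A"
proof -
  \<comment> \<open>The cut is placed at the second smallest index, so that exactly one index lies
    below it.\<close>
  define i :: 'n where "i = Min UNIV"
  define k where "k = Min (UNIV - {i})"
  have ne: "UNIV - {i} \<noteq> {}"
    using card by (metis Diff_eq_empty_iff card_1_singleton_iff card_mono finite finite.emptyI
        finite.insertI is_singletonI is_singleton_altdef not_less)
  have ik: "i < k"
  proof -
    have "k \<in> UNIV - {i}" unfolding k_def using ne by (intro Min_in) auto
    moreover have "i \<le> k" by (simp add: i_def)
    ultimately show ?thesis by auto
  qed
  have lt: "j = i" if "j < k" for j
  proof (rule ccontr)
    assume "j \<noteq> i"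
    then have "k \<le> j" unfolding k_def by (intro Min_le) auto
    then show False using that by simp
  qed
  \<comment> \<open>The phase makes the \<open>i\<close>-th coordinate of the normalised eigenvector
    real, as the reflection requires.\<close>
  obtain \<phi> where \<phi>: "norm \<phi> = 1" "cnj \<phi> * cnj (w $ i) = of_real (norm (cnj (w $ i)))"
    using unit_phase_to_nonneg by blast
  define v where "v = (\<phi> / of_real (norm w)) *s w"
  have "norm v = 1" using w0 \<phi>(1) by (simp add: v_def norm_smult norm_divide)
  then have v1: "herm v v = 1" by (simp add: herm_self)
  have "cnj (v $ i) = of_real (norm (w $ i) / norm w)"
    using \<phi>(2) by (simp add: v_def)
  then have vi: "v $ i \<in> \<real>"
    by (metis complex_cnj_cnj complex_cnj_complex_of_real Reals_of_real)
  have Av: "A *v v = a *s v" and A'v: "conj_transpose A *v v = b *s v"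
    by (simp_all add: v_def vector_scalar_commute Aw A'w vector_smult_assoc mult.commute)
  obtain U where U: "conj_transpose U = U" "U ** U = mat 1" "U *v axis i 1 = v"
    using unitary_self_adjoint_with_column[OF v1 vi] by blast
  have UU: "U *v (U *v x) = x" for x by (simp add: matrix_vector_mul_assoc U)
  then have Uv: "U *v v = axis i 1" by (metis U(3))
  define B where "B = conj_transpose U ** A ** U"
  have Bx: "B *v x = U *v (A *v (U *v x))" for x
    by (simp add: B_def U(1) matrix_vector_mul_assoc matrix_mul_assoc)
  have col: "B *v axis i 1 = a *s axis i 1"
    by (simp add: Bx U(3) Av vector_scalar_commute Uv)
  \<comment> \<open>The eigenvector equation for \<open>A\<close> clears a column of
    \<open>B\<close>; clearing the row takes the one for the adjoint, transported by testing against
    every \<open>x\<close>.\<close>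
  have "herm (conj_transpose B *v axis i 1) x = herm (b *s axis i 1) x" for x
  proof -
    have "herm (conj_transpose B *v axis i 1) x = herm (axis i 1) (U *v (A *v (U *v x)))"
      by (simp add: herm_conj_transpose[symmetric] Bx)
    also have "\<dots> = herm (U *v (conj_transpose A *v (U *v axis i 1))) x"
      by (simp add: herm_conj_transpose U(1))
    also have "\<dots> = herm (b *s axis i 1) x"
      by (simp add: U(3) A'v vector_scalar_commute Uv)
    finally show ?thesis .
  qed
  then have "herm (conj_transpose B *v axis i 1 - b *s axis i 1) x = 0" for x
    by (simp add: herm_diff_left)
  then have row: "conj_transpose B *v axis i 1 = b *s axis i 1"
    by (metis herm_self_eq_0_iff eq_iff_diff_eq_0)
  have ent: "(M *v axis i 1) $ j = M $ j $ i" for M and j :: 'n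
    by (simp add: matrix_vector_mult_def axis_def if_distrib[of "\<lambda>a. _ * a"] cong: if_cong)
  have off: "B $ i $ j = 0 \<and> B $ j $ i = 0" if "j \<noteq> i" for j
    using arg_cong[OF col, of "\<lambda>x. x $ j"] arg_cong[OF row, of "\<lambda>x. x $ j"] that
    unfolding ent by (auto simp: axis_def conj_transpose_def)
  have "is_direct_sum B"
    unfolding is_direct_sum_def
  proof (rule exI[of _ k], intro conjI allI impI)
    show "\<exists>i. i < k" using ik by blast
    fix j l assume "j < k" "k \<le> l"
    then have "j = i" "l \<noteq> i" using lt ik by auto
    then show "B $ j $ l = 0" "B $ l $ j = 0"
      using off by auto
  qed
  moreover have "unitary_matrix U" by (simp add: unitary_matrix_def U)
  ultimately show ?thesis unfolding unitarily_reducible_def B_def by blast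
qed

text \<open>Once normalised, the vectors give the rows of a square matrix whose conjugate transpose
  is a right inverse. It is then also a left inverse, so \<open>v\<close> is recovered from its
  products with the family.\<close>

lemma orthogonal_to_full_family_eq_0:
  fixes f :: "'n \<Rightarrow> complex^'n"
  assumes orth: "\<And>i j. i \<noteq> j \<Longrightarrow> herm (f i) (f j) = 0" and nz: "\<And>i. f i \<noteq> 0"
    and v: "\<And>i. herm (f i) v = 0"
  shows "v = 0"
proof -
  define e where "e i = inverse (of_real (norm (f i))) *s f i" for i
  have e1: "herm (e i) (e i) = 1" for i
    using nz[of i] by (simp add: e_def herm_self norm_smult norm_inverse)
  have e0: "herm (e i) (e j) = 0" if "i \<noteq> j" for i j
    using orth[OF that] by (simp add: e_def herm_linear)
  define M :: "complex^'n^'n" where "M = (\<chi> i j. cnj (e i $ j))"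
  have "(M ** conj_transpose M) $ i $ j = herm (e i) (e j)" for i j
    by (simp add: M_def matrix_matrix_mult_def conj_transpose_def herm_def)
  then have "M ** conj_transpose M = mat 1"
    by (simp add: vec_eq_iff mat_def e0 e1)
  then have "conj_transpose M ** M = mat 1" by (simp add: matrix_left_right_inverse)
  then have "v = conj_transpose M *v (M *v v)" by (simp add: matrix_vector_mul_assoc)
  moreover have "(M *v v) $ i = herm (e i) v" for i
    by (simp add: M_def matrix_vector_mult_def herm_def)
  then have "M *v v = 0" using v by (simp add: vec_eq_iff e_def herm_smult_left)
  ultimately show ?thesis by simp
qed

section \<open>Self-adjoint forms at a critical point\<close>

definition self_adjoint :: "complex^'n^'n \<Rightarrow> bool" where
  "self_adjoint M \<longleftrightarrow> (\<forall>x y. herm x (M *v y) = herm (M *v x) y)"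

lemma self_adjointD: "self_adjoint M \<Longrightarrow> herm x (M *v y) = herm (M *v x) y"
  by (simp add: self_adjoint_def)

lemma self_adjoint_herm_swap: "self_adjoint M \<Longrightarrow> herm x (M *v y) = cnj (herm y (M *v x))"
  by (metis self_adjointD herm_commute)

lemma self_adjoint_form_real:
  "self_adjoint M \<Longrightarrow> herm x (M *v x) = of_real (Re (herm x (M *v x)))"
  by (metis self_adjoint_herm_swap Reals_cnj_iff of_real_Re)

lemma matrix_uminus_mult_vec: "(- M) *v v = - (M *v (v :: complex^'n))"
  by (simp add: vec_eq_iff matrix_vector_mult_def sum_negf)

lemma self_adjoint_uminus: "self_adjoint M \<Longrightarrow> self_adjoint (- M)"
  by (simp add: self_adjoint_def matrix_uminus_mult_vec herm_uminus)

text \<open>Otherwise a small step from \<open>x\<close> against \<open>M *v x\<close> would make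
  the form negative: the loss is of first order in the step length, the gain only of second
  order.\<close>

lemma pos_semidef_form_eq_0D:
  fixes M :: "complex^'n^'n"
  assumes M: "self_adjoint M" and pos: "\<And>x. 0 \<le> Re (herm x (M *v x))"
    and x: "herm x (M *v x) = 0"
  shows "M *v x = 0"
proof (rule ccontr)
  assume nz: "M *v x \<noteq> 0"
  define g where "g = M *v x"
  define q where "q = Re (herm g (M *v g))"
  have 0: "0 < (norm g)\<^sup>2" using nz by (simp add: g_def)
  have q0: "0 \<le> q" using pos by (simp add: q_def)
  \<comment> \<open>Chosen so that \<open>\<epsilon> * q\<close> is at most the squared norm of
    \<open>g\<close>; the summand 1 covers \<open>q = 0\<close>.\<close>
  define \<epsilon> where "\<epsilon> = (norm g)\<^sup>2 / (q + 1)"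
  have e0: "0 < \<epsilon>" using 0 q0 by (simp add: \<epsilon>_def)
  have xg: "herm x (M *v g) = of_real ((norm g)\<^sup>2)"
    using self_adjointD[OF M, of x g] by (simp add: g_def[symmetric] herm_self)
  have gx: "herm g (M *v x) = of_real ((norm g)\<^sup>2)"
    by (simp add: g_def[symmetric] herm_self)
  have "0 \<le> Re (herm (x - of_real \<epsilon> *s g) (M *v (x - of_real \<epsilon> *s g)))" by (rule pos)
  also have "\<dots> = - 2 * \<epsilon> * (norm g)\<^sup>2 + \<epsilon>\<^sup>2 * q"
    by (simp add: matrix_vector_mult_diff_distrib vector_scalar_commute herm_linear x xg gx q_def
        power2_eq_square algebra_simps)
  finally have "\<epsilon> * (2 * (norm g)\<^sup>2) \<le> \<epsilon> * (\<epsilon> * q)" by (simp add: power2_eq_square algebra_simps)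
  then have "2 * (norm g)\<^sup>2 \<le> \<epsilon> * q" using e0 by simp
  also have "\<epsilon> * q \<le> (norm g)\<^sup>2"
    using q0 0 by (simp add: \<epsilon>_def field_simps)
  finally show False using 0 by simp
qed

text \<open>Moving from \<open>x\<^sub>0\<close> in the direction \<open>\<phi> y\<close>, the form of \<open>K\<close> does not depend on the phase
  \<open>\<phi>\<close>, so that \<open>\<phi>\<close> can be spent on adjusting the form of \<open>H\<close>.\<close>

lemma nearby_unit_vector_with_values:
  fixes K H :: "complex^'n^'n"
  assumes K: "self_adjoint K" and H: "self_adjoint H"
    and x0: "herm x0 x0 = 1" "K *v x0 = 0" "herm x0 (H *v x0) = 0"
    and y: "herm x0 y = 0" "norm y \<le> 1 / 2" "herm y (H *v x0) = of_real m" "m > 0"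
    and bound: "\<bar>s\<bar> + norm (herm y (H *v y)) \<le> m"
  obtains x where "herm x x = 1" "dist x x0 \<le> 2 * norm y"
    "herm x (K *v x) = herm y (K *v y)" "herm x (H *v x) = of_real s"
proof -
  \<comment> \<open>The coefficient of \<open>x0\<close> that makes the sum a unit vector,
    \<open>y\<close> being orthogonal to \<open>x0\<close>.\<close>
  define a where "a = sqrt (1 - (norm y)\<^sup>2)"
  have y2: "(norm y)\<^sup>2 \<le> 1" using y(2) by (simp add: power_le_one)
  then have aa: "a\<^sup>2 = 1 - (norm y)\<^sup>2" by (simp add: a_def)
  have "(1 - norm y)\<^sup>2 \<le> 1 - (norm y)\<^sup>2"
    using mult_left_mono[of "norm y" 1 "norm y"] y(2) by (simp add: power2_eq_square algebra_simps)
  then have a1: "1 - norm y \<le> a" unfolding a_def by (rule real_le_rsqrt)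
  have a2: "a \<le> 1" by (simp add: a_def)
  define q where "q = Re (herm y (H *v y))"
  have q: "herm y (H *v y) = of_real q" unfolding q_def by (rule self_adjoint_form_real[OF H])
  \<comment> \<open>The form of \<open>H\<close> at \<open>a x0 + \<phi> y\<close> is
    \<open>2 a m Re \<phi> + q\<close>, so \<open>c\<close> is the real part that the phase must
    have. Since \<open>a\<close> is at least 1/2, \<open>bound\<close> yields |c| \<le> 1.\<close>
  define c where "c = (s - q) / (2 * a * m)"
  have am: "m \<le> 2 * a * m" using a1 y(2,4) by simp
  have "\<bar>s - q\<bar> \<le> 2 * a * m" using bound am by (simp add: q)
  then have c1: "\<bar>c\<bar> \<le> 1" using am y(4) by (simp add: c_def abs_divide)
  have c: "2 * a * m * c = s - q" using am y(4) by (simp add: c_def)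
  define \<phi> where "\<phi> = Complex c (sqrt (1 - c\<^sup>2))"
  have "c\<^sup>2 \<le> 1" using c1 by (simp add: abs_square_le_1)
  then have n: "norm \<phi> = 1" by (simp add: \<phi>_def cmod_def)
  then have nn: "\<phi> * cnj \<phi> = 1" using complex_norm_square[of \<phi>] by simp
  have nn': "cnj \<phi> * (\<phi> * z) = z" "\<phi> * (cnj \<phi> * z) = z" for z
    using nn mult.commute[of \<phi> "cnj \<phi>"] by (simp_all flip: mult.assoc)
  have re: "\<phi> + cnj \<phi> = of_real (2 * c)" by (simp add: \<phi>_def complex_eq_iff)
  define x where "x = of_real a *s x0 + \<phi> *s y"
  have y0: "herm y x0 = 0" using y(1) herm_commute[of y x0] by simp
  have x0K: "herm x0 (K *v z) = 0" for z using self_adjointD[OF K, of x0 z] x0(2) by simp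
  have x0H: "herm x0 (H *v y) = of_real m"
    using self_adjoint_herm_swap[OF H, of x0 y] y(3) by simp
  show ?thesis
  proof (rule that)
    have "herm x x = of_real a * of_real a + herm y y"
      by (simp add: x_def herm_linear x0 y y0 nn')
    also have "\<dots> = of_real (a\<^sup>2 + (norm y)\<^sup>2)" by (simp add: herm_self power2_eq_square)
    finally show "herm x x = 1" by (simp add: aa)
    have nx0: "norm x0 = 1" using x0(1) unit_sphere_eq by (auto simp: unit_sphere_def)
    have "x - x0 = of_real (a - 1) *s x0 + \<phi> *s y"
      by (simp add: x_def vec_eq_iff algebra_simps)
    then have "dist x x0 \<le> norm (complex_of_real (a - 1) *s x0) + norm (\<phi> *s y)"
      unfolding dist_norm by (metis norm_triangle_ineq)
    also have "\<dots> = \<bar>a - 1\<bar> + norm y" unfolding norm_smult n nx0 norm_of_real by simp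
    finally show "dist x x0 \<le> 2 * norm y" using a1 a2 by simp
    show "herm x (K *v x) = herm y (K *v y)"
      by (simp add: x_def matrix_vector_right_distrib vector_scalar_commute herm_linear x0 x0K nn')
    have "herm x (H *v x) = of_real a * of_real m * (\<phi> + cnj \<phi>) + of_real q"
      by (simp add: x_def matrix_vector_right_distrib vector_scalar_commute herm_linear x0 x0H y q
          nn' algebra_simps)
    also have "\<dots> = of_real (2 * a * m * c + q)" unfolding re by simp
    also have "\<dots> = of_real s" unfolding c by simp
    finally show "herm x (H *v x) = of_real s" .
  qed
qed

text \<open>The intermediate value theorem on a scaled copy of the segment from \<open>y0\<close> to
  \<open>y1\<close> hits the value of \<open>K\<close>, and a phase then corrects the value of
  \<open>H\<close>. The product with \<open>H *v x0\<close> is affine along the segment, so it stays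
  positive. At an end where the form of \<open>K\<close> is zero, semidefiniteness puts the target
  value on the right side.\<close>

lemma joint_form_open_at:
  fixes K H :: "complex^'n^'n"
  assumes K: "self_adjoint K" and H: "self_adjoint H"
    and x0: "herm x0 x0 = 1" "K *v x0 = 0" "herm x0 (H *v x0) = 0"
    and y0: "herm x0 y0 = 0" "herm y0 (H *v x0) = of_real m0" "m0 > 0"
    and y1: "herm x0 y1 = 0" "herm y1 (H *v x0) = of_real m1" "m1 > 0"
    and k0: "Re (herm y0 (K *v y0)) < 0 \<or>
      Re (herm y0 (K *v y0)) = 0 \<and> (\<forall>x. 0 \<le> Re (herm x (K *v x)))"
    and k1: "0 < Re (herm y1 (K *v y1)) \<or>
      Re (herm y1 (K *v y1)) = 0 \<and> (\<forall>x. Re (herm x (K *v x)) \<le> 0)"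
    and e: "0 < e"
  shows "\<exists>d>0. \<forall>x'. norm (herm x' (K *v x')) < d \<and> norm (herm x' (H *v x')) < d \<longrightarrow>
    (\<exists>x. herm x x = 1 \<and> dist x x0 < e \<and>
      herm x (K *v x) = herm x' (K *v x') \<and> herm x (H *v x) = herm x' (H *v x'))"
proof -
  define y where "y \<tau> = (1 - \<tau>) *\<^sub>R y0 + \<tau> *\<^sub>R y1" for \<tau>
  define k where "k \<tau> = Re (herm (y \<tau>) (K *v y \<tau>))" for \<tau>
  define m where "m = min m0 m1"
  have m: "0 < m" using y0 y1 by (simp add: m_def)
  have y_cont: "continuous_on {0..1} y" unfolding y_def by (intro continuous_intros)
  have k_cont: "continuous_on {0..1} k" unfolding k_def by (intro continuous_intros y_cont)
  have "compact (y ` {0..1})" by (intro compact_continuous_image y_cont compact_Icc)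
  then obtain B1 where B1: "\<And>\<tau>. \<tau> \<in> {0..1} \<Longrightarrow> norm (y \<tau>) \<le> B1"
    by (meson compact_imp_bounded bounded_iff imageI)
  have "compact ((\<lambda>\<tau>. herm (y \<tau>) (H *v y \<tau>)) ` {0..1})"
    by (intro compact_continuous_image continuous_intros y_cont compact_Icc)
  then obtain B2 where B2: "\<And>\<tau>. \<tau> \<in> {0..1} \<Longrightarrow> norm (herm (y \<tau>) (H *v y \<tau>)) \<le> B2"
    by (fastforce dest!: compact_imp_bounded simp: bounded_iff)
  define B where "B = max 1 (max B1 B2)"
  have B: "0 < B" "B1 \<le> B" "B2 \<le> B" by (auto simp: B_def)
  \<comment> \<open>Scaling by \<open>r\<close> keeps the segment within the required distances, and
    makes the quadratic contribution of \<open>H\<close> at most half of the linear room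
    \<open>r * m\<close>.\<close>
  define r where "r = min 1 (min e m) / (4 * B)"
  have r: "0 < r" using e m B by (simp add: r_def)
  have "4 * (r * B) = min 1 (min e m)" using B by (simp add: r_def)
  then have rB: "r * B \<le> 1 / 2" "2 * (r * B) < e" "r * B \<le> m / 2" using e m r B by auto
  \<comment> \<open>The other half of the room is left for \<open>s\<close>. The remaining bounds
    keep \<open>t\<close> between the scaled end values; 1 is a placeholder at an end where the sign
    of \<open>t\<close> is already known.\<close>
  define d where "d = min (m * r / 2) (min (if k 0 < 0 then - k 0 * r\<^sup>2 else 1)
    (if 0 < k 1 then k 1 * r\<^sup>2 else 1))"
  have "0 < d" using m r by (auto simp: d_def intro!: mult_neg_pos)
  moreover have "\<exists>x. herm x x = 1 \<and> dist x x0 < e \<and>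
      herm x (K *v x) = herm x' (K *v x') \<and> herm x (H *v x) = herm x' (H *v x')"
    if x': "norm (herm x' (K *v x')) < d" "norm (herm x' (H *v x')) < d" for x'
  proof -
    define t where "t = Re (herm x' (K *v x'))"
    define s where "s = Re (herm x' (H *v x'))"
    have t: "herm x' (K *v x') = of_real t" unfolding t_def by (rule self_adjoint_form_real[OF K])
    have s: "herm x' (H *v x') = of_real s" unfolding s_def by (rule self_adjoint_form_real[OF H])
    have td: "\<bar>t\<bar> < d" and sd: "\<bar>s\<bar> < d" using x' by (simp_all add: t s)
    have "r\<^sup>2 * k 0 \<le> t"
      using k0 td unfolding d_def k_def y_def by (auto simp: t_def mult.commute)
    moreover have "t \<le> r\<^sup>2 * k 1"
      using k1 td unfolding d_def k_def y_def by (auto simp: t_def mult.commute)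
    ultimately have "k 0 \<le> t / r\<^sup>2" "t / r\<^sup>2 \<le> k 1" using r by (simp_all add: field_simps)
    then obtain \<tau> where \<tau>: "\<tau> \<in> {0..1}" "k \<tau> = t / r\<^sup>2"
      using IVT'[of k 0 "t / r\<^sup>2" 1] k_cont by auto
    define z where "z = of_real r *s y \<tau>"
    have zK: "herm z (K *v z) = of_real t"
    proof -
      have "herm (y \<tau>) (K *v y \<tau>) = of_real (t / r\<^sup>2)"
        using self_adjoint_form_real[OF K, of "y \<tau>"] \<tau>(2) by (simp add: k_def)
      then show ?thesis using r by (simp add: z_def vector_scalar_commute herm_linear power2_eq_square)
    qed
    have zH: "norm (herm z (H *v z)) \<le> m * r / 2"
    proof -
      have "norm (herm z (H *v z)) = r * (r * norm (herm (y \<tau>) (H *v y \<tau>)))"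
        using r by (simp add: z_def vector_scalar_commute herm_linear norm_mult)
      also have "\<dots> \<le> r * (r * B)"
        using r B2[OF \<tau>(1)] B by (intro mult_left_mono) auto
      also have "\<dots> \<le> r * (m / 2)" using rB r by (intro mult_left_mono) auto
      finally show ?thesis by (simp add: mult.commute)
    qed
    have nz: "norm z \<le> r * B"
      using r B1[OF \<tau>(1)] B by (simp add: z_def norm_smult)
    define l where "l = r * ((1 - \<tau>) * m0 + \<tau> * m1)"
    have zl: "herm z (H *v x0) = of_real l"
      by (simp add: z_def y_def scaleR_eq_smult herm_linear y0 y1 l_def algebra_simps)
    have "(1 - \<tau>) * m + \<tau> * m \<le> (1 - \<tau>) * m0 + \<tau> * m1"
      using \<tau>(1) by (intro add_mono mult_left_mono) (auto simp: m_def)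
    then have "m \<le> (1 - \<tau>) * m0 + \<tau> * m1" by (simp add: algebra_simps)
    then have ml: "r * m \<le> l" using r unfolding l_def by (intro mult_left_mono) auto
    have l: "0 < l" using ml r m by (meson mult_pos_pos less_le_trans)
    have x0z: "herm x0 z = 0" by (simp add: z_def y_def scaleR_eq_smult herm_linear y0 y1)
    have "\<bar>s\<bar> \<le> m * r / 2" using sd by (simp add: d_def)
    then have "\<bar>s\<bar> + norm (herm z (H *v z)) \<le> l" using zH ml by (simp add: mult.commute)
    moreover have "norm z \<le> 1 / 2" using nz rB by simp
    ultimately obtain x where "herm x x = 1" "dist x x0 \<le> 2 * norm z"
      "herm x (K *v x) = herm z (K *v z)" "herm x (H *v x) = of_real s"
      using nearby_unit_vector_with_values[OF K H x0 x0z _ zl l] by blast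
    then show ?thesis using nz rB by (auto simp: zK t s intro!: exI[of _ x])
  qed
  ultimately show ?thesis by blast
qed

text \<open>This provides the end \<open>y0\<close> of the segment in
  \<open>joint_form_open_at\<close>, and \<open>y1\<close> when applied to \<open>- K\<close>. If
  \<open>K\<close> takes a negative value, a vector attaining one is adjusted. If not, the second
  preimage \<open>x\<close> lies in the kernel of \<open>K\<close>, and its part orthogonal to
  \<open>x0\<close> serves; dimension three excludes that this part is orthogonal to
  \<open>H *v x0\<close>.\<close>

lemma exists_direction_below:
  fixes K H :: "complex^3^3"
  assumes K: "self_adjoint K" and H: "self_adjoint H"
    and x0: "herm x0 x0 = 1" "K *v x0 = 0" "herm x0 (H *v x0) = 0"
    and ker: "\<And>w. K *v w = 0 \<Longrightarrow> H *v w = 0 \<Longrightarrow> w = 0"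
    and x: "herm x x = 1" "herm x (K *v x) = 0" "herm x (H *v x) = 0"
      "\<And>\<phi>. norm \<phi> = 1 \<Longrightarrow> x \<noteq> \<phi> *s x0"
  obtains y m where "herm x0 y = 0" "herm y (H *v x0) = of_real m" "m > 0"
    "Re (herm y (K *v y)) < 0 \<or> Re (herm y (K *v y)) = 0 \<and> (\<forall>x. 0 \<le> Re (herm x (K *v x)))"
proof -
  define g where "g = H *v x0"
  have g0: "g \<noteq> 0" using ker[of x0] x0 by (auto simp: g_def)
  have x0g: "herm x0 g = 0" using x0 by (simp add: g_def)
  have x0K: "herm x0 (K *v z) = 0" for z using self_adjointD[OF K, of x0 z] x0(2) by simp
  note result = that
  \<comment> \<open>A phase makes the product with \<open>g\<close> positive without changing the
    form of \<open>K\<close>, so a nonzero product suffices.\<close>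
  have phase: thesis
    if "herm x0 u = 0" "herm u g \<noteq> 0"
      "Re (herm u (K *v u)) < 0 \<or> Re (herm u (K *v u)) = 0 \<and> (\<forall>x. 0 \<le> Re (herm x (K *v x)))" for u
  proof -
    obtain \<phi> where \<phi>: "norm \<phi> = 1" "cnj \<phi> * herm u g = of_real (norm (herm u g))"
      using unit_phase_to_nonneg by blast
    have "cnj \<phi> * \<phi> = 1"
      using complex_norm_square[of \<phi>] \<phi>(1) by (simp add: mult.commute)
    then have "herm (\<phi> *s u) (K *v (\<phi> *s u)) = herm u (K *v u)"
      by (simp add: vector_scalar_commute herm_scale)
    moreover have "herm (\<phi> *s u) (H *v x0) = of_real (norm (herm u g))"
      using \<phi>(2) by (simp add: herm_smult_left g_def)
    ultimately show ?thesis
      using that by (intro result[of "\<phi> *s u" "norm (herm u g)"]) (auto simp: herm_smult_right)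
  qed
  show ?thesis
  proof (cases "\<forall>x. 0 \<le> Re (herm x (K *v x))")
    case True
    then have Kx: "K *v x = 0" using pos_semidef_form_eq_0D[OF K _ x(2)] by blast
    define c where "c = herm x0 x"
    define u where "u = x - c *s x0"
    have xu: "x = u + c *s x0" by (simp add: u_def)
    have Ku: "K *v u = 0" by (simp add: u_def matrix_vector_mult_diff_distrib vector_scalar_commute Kx x0)
    have x0u: "herm x0 u = 0" by (simp add: u_def herm_linear x0 c_def)
    have ux0: "herm u x0 = 0" using x0u herm_commute[of u x0] by simp
    have u0: "u \<noteq> 0"
    proof
      assume "u = 0"
      then have xc: "x = c *s x0" using xu by simp
      have "norm x = 1" "norm x0 = 1"
        using x(1) x0(1) unit_sphere_eq by (auto simp: unit_sphere_def)
      then have "norm c = 1" using norm_smult[of c x0] xc by simp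
      then show False using x(4) xc by blast
    qed
    have "herm u g \<noteq> 0"
    proof
      assume ug: "herm u g = 0"
      have gu: "herm g u = 0" using ug herm_commute[of g u] by simp
      have gx0: "herm g x0 = 0" using x0g herm_commute[of g x0] by simp
      have x0Hu: "herm x0 (H *v u) = 0" using self_adjointD[OF H, of x0 u] gu by (simp add: g_def)
      have uHu: "herm u (H *v u) = 0"
        using x(3) unfolding xu
        by (simp add: matrix_vector_right_distrib vector_scalar_commute herm_linear x0Hu x0
            ug[unfolded g_def])
      \<comment> \<open>\<open>H *v u\<close> is orthogonal to \<open>x0\<close> and
        \<open>u\<close>, so in dimension three it equals its projection
        \<open>\<gamma> *s g\<close>. Then \<open>K\<close> and \<open>H\<close> both annihilate
        \<open>u - \<gamma> *s x0\<close>, against \<open>ker\<close>.\<close>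
      define \<gamma> where "\<gamma> = herm g (H *v u) / herm g g"
      define v where "v = H *v u - \<gamma> *s g"
      have gv: "herm g v = 0" using g0 by (simp add: v_def herm_linear \<gamma>_def)
      define f :: "3 \<Rightarrow> complex^3" where "f i = (if i = 1 then x0 else if i = 2 then u else g)" for i
      have "v = 0"
      proof (rule orthogonal_to_full_family_eq_0[of f])
        show "herm (f i) (f j) = 0" if "i \<noteq> j" for i j
          using that exhaust_3[of i] exhaust_3[of j] by (auto simp: f_def x0g gx0 x0u ux0 ug gu)
        show "f i \<noteq> 0" for i using g0 u0 x0(1) by (auto simp: f_def)
        show "herm (f i) v = 0" for i
          using gv by (simp add: f_def v_def herm_linear x0Hu uHu x0g ug)
      qed
      then have "H *v (u - \<gamma> *s x0) = 0"
        by (simp add: matrix_vector_mult_diff_distrib vector_scalar_commute v_def g_def)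
      moreover have "K *v (u - \<gamma> *s x0) = 0"
        by (simp add: matrix_vector_mult_diff_distrib vector_scalar_commute Ku x0)
      ultimately have "u - \<gamma> *s x0 = 0" using ker by blast
      then have "herm u (u - \<gamma> *s x0) = 0" by simp
      then have "herm u u = 0" by (simp add: herm_linear ux0)
      then show False using u0 by simp
    qed
    then show ?thesis using phase[OF x0u] True by (simp add: Ku)
  next
    case False
    then obtain x where x: "Re (herm x (K *v x)) < 0" by (auto simp: not_le)
    define u where "u = x - herm x0 x *s x0"
    have "K *v u = K *v x"
      by (simp add: u_def matrix_vector_mult_diff_distrib vector_scalar_commute x0)
    then have uK: "Re (herm u (K *v u)) < 0"
      using x by (simp add: u_def herm_linear x0K)
    have x0u: "herm x0 u = 0" by (simp add: u_def herm_linear x0)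
    show ?thesis
    proof (cases "herm u g = 0")
      case False
      then show ?thesis using phase[OF x0u] uK by simp
    next
      case True
      \<comment> \<open>Adding a small multiple of \<open>g\<close>, itself orthogonal to
        \<open>x0\<close>, makes the product with \<open>g\<close> nonzero; by continuity the form
        of \<open>K\<close> stays negative.\<close>
      have "continuous_on UNIV (\<lambda>\<epsilon>. Re (herm (u + \<epsilon> *\<^sub>R g) (K *v (u + \<epsilon> *\<^sub>R g))))"
        by (intro continuous_intros)
      then have "((\<lambda>\<epsilon>. Re (herm (u + \<epsilon> *\<^sub>R g) (K *v (u + \<epsilon> *\<^sub>R g)))) \<longlongrightarrow> Re (herm u (K *v u))) (at_right 0)"
        unfolding continuous_on_def
        by (metis (no_types, lifting) UNIV_I add.right_neutral filterlim_at_split scaleR_zero_left)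
      then have "\<forall>\<^sub>F \<epsilon> in at_right 0. Re (herm (u + \<epsilon> *\<^sub>R g) (K *v (u + \<epsilon> *\<^sub>R g))) < 0"
        using uK by (rule order_tendstoD)
      then have "\<forall>\<^sub>F \<epsilon> in at_right 0. Re (herm (u + \<epsilon> *\<^sub>R g) (K *v (u + \<epsilon> *\<^sub>R g))) < 0 \<and> 0 < \<epsilon>"
        by (intro eventually_conj eventually_at_right_less)
      then obtain \<epsilon> :: real where \<epsilon>: "0 < \<epsilon>"
        "Re (herm (u + \<epsilon> *\<^sub>R g) (K *v (u + \<epsilon> *\<^sub>R g))) < 0"
        using eventually_happens'[OF trivial_limit_at_right_real] by blast
      show ?thesis
        by (rule phase[of "u + \<epsilon> *\<^sub>R g"])
          (use \<epsilon> True g0 x0u x0g in \<open>auto simp: scaleR_eq_smult herm_linear\<close>)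
    qed
  qed
qed

section \<open>Openness of the numerical map on the sphere\<close>

text \<open>Dividing the form by \<open>herm x x\<close> removes the constraint to the sphere, so an
  open mapping theorem applies on a ball around \<open>x0\<close>; the solution is normalised
  afterwards.\<close>

lemma fov_open_at_regular_point:
  fixes A :: "complex^'n^'n"
  assumes x0: "x0 \<in> unit_sphere" and z0: "herm x0 (A *v x0) = z0" and e: "0 < e"
    and reg: "surj (\<lambda>y. herm x0 (A *v y - z0 *s y) + herm y (A *v x0 - z0 *s x0))"
  shows "\<exists>d>0. \<forall>z. dist z z0 < d \<longrightarrow>
    (\<exists>x\<in>unit_sphere. dist x x0 < e \<and> herm x (A *v x) = z)"
proof -
  define B where "B y = A *v y - z0 *s y" for y
  have B_lin: "bounded_linear B"
    using bounded_linear_sub[OF bounded_linear_matrix_complex[of A]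
        bounded_linear_matrix_complex[of "mat z0"]]
    unfolding B_def mat_complex_mult_vec .
  note der = bounded_bilinear.FDERIV[OF bounded_bilinear_herm]
  define T where "T y = herm x0 (B y) + herm y (B x0)" for y
  define F where "F x = herm x (B x) / herm x x" for x
  have x01: "herm x0 x0 = 1" using x0 by (simp add: unit_sphere_def)
  have n0: "norm x0 = 1" using x0 unit_sphere_eq by auto
  have Bx0: "herm x0 (B x0) = 0" by (simp add: B_def herm_linear z0 x01)
  have num: "((\<lambda>x. herm x (B x)) has_derivative T) (at x0)"
    unfolding T_def
    by (rule der[OF has_derivative_ident bounded_linear_imp_has_derivative[OF B_lin]])
  have den: "((\<lambda>x. herm x x) has_derivative (\<lambda>y. herm x0 y + herm y x0)) (at x0)"
    by (rule der[OF has_derivative_ident has_derivative_ident])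
  \<comment> \<open>The shift by \<open>z0\<close> makes the numerator vanish at \<open>x0\<close>,
    where the denominator is 1; so the quotient inherits the derivative of the numerator.\<close>
  have derF: "(F has_derivative T) (at x0)"
    using has_derivative_divide[OF num den] x01 unfolding F_def Bx0 by simp
  have lin: "linear T" using has_derivative_linear[OF num] .
  have "surj T" using reg unfolding T_def B_def .
  then obtain g where g: "linear g" "T \<circ> g = id"
    using linear_surjective_right_inverse[OF lin] by blast
  have cont: "continuous_on (- {0}) F"
    unfolding F_def
    by (intro continuous_intros bounded_linear.continuous_on[OF B_lin]) auto
  define r where "r = min (1 / 2) (e / 4)"
  have r: "0 < r" "r < 1" "2 * r < e" using e by (auto simp: r_def)
  have nz: "ball x0 r \<subseteq> - {0}" using r n0 by (auto simp: dist_norm)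
  have "F x0 \<in> interior (F ` ball x0 r)"
    by (rule sussmann_open_mapping[OF _ cont _ derF _ g(2) nz])
      (use g(1) n0 r in \<open>auto simp: linear_conv_bounded_linear open_Compl interior_open\<close>)
  then obtain d where d: "0 < d" "ball 0 d \<subseteq> F ` ball x0 r"
    unfolding mem_interior by (auto simp: F_def Bx0)
  have "\<exists>x\<in>unit_sphere. dist x x0 < e \<and> herm x (A *v x) = z" if "dist z z0 < d" for z
  proof -
    have "z - z0 \<in> ball 0 d" using that by (simp add: dist_norm norm_minus_commute)
    then obtain y where y: "y \<in> ball x0 r" "F y = z - z0" using d by force
    have y0: "y \<noteq> 0" using nz y by auto
    define c where "c = complex_of_real (inverse (norm y))"
    define x where "x = c *s y"
    have nc: "cnj c = c" and yy: "c * c * herm y y = 1"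
      using y0 by (simp_all add: c_def herm_self field_simps power2_eq_square)
    have xx: "herm x x = 1" using yy by (simp add: x_def herm_linear nc mult_ac)
    have "herm x (A *v x) = c * c * (herm y (B y) + z0 * herm y y)"
      by (simp add: x_def vector_scalar_commute herm_linear nc B_def mult_ac)
    also have "\<dots> = c * c * herm y y * (F y + z0)"
      using y0 by (simp add: F_def field_simps)
    finally have fx: "herm x (A *v x) = z" by (simp add: yy y(2))
    \<comment> \<open>Normalising moves \<open>y\<close> by the difference of its norm from that of
      \<open>x0\<close>, so the distance to \<open>x0\<close> at most doubles.\<close>
    have "x - y = (c - 1) *s y" by (simp add: x_def vec_eq_iff algebra_simps)
    then have "dist x y = norm (c - 1) * norm y" by (simp only: dist_norm norm_smult)
    also have "c - 1 = of_real (inverse (norm y) - 1)" by (simp add: c_def)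
    also have "norm (complex_of_real (inverse (norm y) - 1)) * norm y
        = \<bar>(inverse (norm y) - 1) * norm y\<bar>"
      by (simp only: norm_of_real abs_mult abs_norm_cancel)
    also have "\<dots> = \<bar>norm x0 - norm y\<bar>" using y0 by (simp add: left_diff_distrib n0)
    also have "\<dots> \<le> dist x0 y" by (simp add: dist_norm norm_triangle_ineq3)
    finally have "dist x x0 \<le> 2 * dist x0 y"
      using dist_triangle[of x x0 y] by (simp add: dist_commute)
    then show ?thesis using xx fx y(1) r by (auto simp: unit_sphere_def intro!: bexI[of _ x])
  qed
  then show ?thesis using d(1) by blast
qed

text \<open>Unit vectors all of whose phase multiples stay at least \<open>e\<close> away from
  \<open>x0\<close> form a compact set, on which the value keeps a positive distance from
  \<open>z0\<close>. A vector with value closer to \<open>z0\<close> therefore has a phase multiple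
  near \<open>x0\<close>.\<close>

lemma fov_open_at_unique_preimage:
  fixes A :: "complex^'n^'n"
  assumes e: "0 < e"
    and uniq: "\<And>x. x \<in> unit_sphere \<Longrightarrow> herm x (A *v x) = z0 \<Longrightarrow> \<exists>\<phi>. norm \<phi> = 1 \<and> x = \<phi> *s x0"
  shows "\<exists>d>0. \<forall>x'\<in>unit_sphere. dist (herm x' (A *v x')) z0 < d \<longrightarrow>
    (\<exists>x\<in>unit_sphere. dist x x0 < e \<and> herm x (A *v x) = herm x' (A *v x'))"
proof -
  have phase: "cnj \<phi> * \<phi> = 1" if "norm \<phi> = 1" for \<phi>
    using complex_norm_square[of \<phi>] that by (simp add: mult.commute)
  define S where "S = unit_sphere \<inter> (\<Inter>\<phi>\<in>sphere 0 1. {x. e \<le> dist (\<phi> *s x) x0})"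
  have "closed {x. e \<le> dist (\<phi> *s x) x0}" for \<phi>
    unfolding mat_complex_mult_vec[symmetric] by (intro closed_Collect_le continuous_intros)
  then have "compact S" unfolding S_def unit_sphere_eq by (intro compact_Int_closed closed_INT) auto
  have pos: "0 < dist (herm x (A *v x)) z0" if x: "x \<in> S" for x
  proof (rule ccontr)
    assume "\<not> 0 < dist (herm x (A *v x)) z0"
    then obtain \<phi> where \<phi>: "norm \<phi> = 1" "x = \<phi> *s x0" using uniq[of x] x by (auto simp: S_def)
    then have "cnj \<phi> *s x = x0" using phase[OF \<phi>(1)] by (simp add: vector_smult_assoc)
    moreover have "cnj \<phi> \<in> sphere 0 1" using \<phi>(1) by simp
    moreover have "\<forall>\<psi>\<in>sphere 0 1. e \<le> dist (\<psi> *s x) x0" using x by (simp add: S_def)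
    ultimately have "e \<le> dist x0 x0" by metis
    then show False using e by simp
  qed
  obtain d where d: "0 < d" "\<And>x. x \<in> S \<Longrightarrow> d \<le> dist (herm x (A *v x)) z0"
  proof (cases "S = {}")
    case True
    then show ?thesis using that[of 1] by simp
  next
    case False
    have "continuous_on S (\<lambda>x. dist (herm x (A *v x)) z0)" by (intro continuous_intros)
    from continuous_attains_inf[OF \<open>compact S\<close> False this] show ?thesis
      using that pos by blast
  qed
  have "\<exists>x\<in>unit_sphere. dist x x0 < e \<and> herm x (A *v x) = herm x' (A *v x')"
    if x': "x' \<in> unit_sphere" "dist (herm x' (A *v x')) z0 < d" for x'
  proof -
    have "x' \<notin> S" using d(2)[of x'] x'(2) by auto
    then obtain \<phi> where \<phi>: "norm \<phi> = 1" "dist (\<phi> *s x') x0 < e"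
      using x'(1) by (auto simp: S_def not_le)
    have "herm (\<phi> *s x') (A *v (\<phi> *s x')) = herm x' (A *v x')"
      by (simp add: vector_scalar_commute herm_scale phase[OF \<phi>(1)])
    moreover have "\<phi> *s x' \<in> unit_sphere"
      using x'(1) by (simp add: unit_sphere_def herm_scale phase[OF \<phi>(1)])
    ultimately show ?thesis using \<phi>(2) by blast
  qed
  then show ?thesis using d(1) by blast
qed

text \<open>The range is a proper real subspace of the plane, and the real inner product of
  \<open>w\<close> and \<open>v\<close> is the real part of \<open>cnj w * v\<close>.\<close>

lemma proper_range_orthogonal_direction:
  fixes T :: "'a::euclidean_space \<Rightarrow> complex"
  assumes "linear T" "\<not> surj T"
  obtains \<omega> where "norm \<omega> = 1" "\<And>y. Re (cnj \<omega> * T y) = 0"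
proof -
  have sp: "span (range T) = range T"
    using assms(1) by (simp add: linear_subspace_image span_eq_iff)
  then have "span (range T) \<subset> span UNIV"
    using assms(2) by (metis span_UNIV psubsetI subset_UNIV)
  then obtain w where w: "w \<noteq> 0" "\<And>v. v \<in> span (range T) \<Longrightarrow> orthogonal w v"
    by (rule orthogonal_to_subspace_exists_gen) blast
  have "Re (cnj (sgn w) * T y) = 0" for y
  proof -
    have "inner w (T y) = 0" using w(2)[of "T y"] sp by (simp add: orthogonal_def)
    then show ?thesis by (simp add: inner_complex_def sgn_div_norm flip: distrib_left)
  qed
  then show ?thesis using that[of "sgn w"] w(1) by (simp add: norm_sgn)
qed

lemma fov_open_at:
  fixes A :: "complex^3^3"
  assumes irr: "unitarily_irreducible A"
    and x0: "x0 \<in> unit_sphere" and e: "0 < e"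
  shows "\<exists>d>0. \<forall>x'\<in>unit_sphere. dist (herm x' (A *v x')) (herm x0 (A *v x0)) < d \<longrightarrow>
    (\<exists>x\<in>unit_sphere. dist x x0 < e \<and> herm x (A *v x) = herm x' (A *v x'))"
proof -
  define z0 where "z0 = herm x0 (A *v x0)"
  have x01: "herm x0 x0 = 1" using x0 by (simp add: unit_sphere_def)
  define T where "T y = herm x0 (A *v y - z0 *s y) + herm y (A *v x0 - z0 *s x0)" for y
  show ?thesis
  proof (cases "surj T")
    case True
    then show ?thesis
      using fov_open_at_regular_point[OF x0 z0_def[symmetric] e] unfolding T_def z0_def by blast
  next
    case False
    have "linear T"
      by (rule linearI) (simp_all add: T_def matrix_vector_right_distrib scaleR_eq_smult
          vector_scalar_commute herm_linear scaleR_conv_of_real algebra_simps)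
    then obtain \<omega> where \<omega>: "norm \<omega> = 1" "\<And>y. Re (cnj \<omega> * T y) = 0"
      using proper_range_orthogonal_direction False by blast
    have \<omega>0: "\<omega> \<noteq> 0" using \<omega>(1) by auto
    \<comment> \<open>Multiplication by \<open>cnj \<omega>\<close> turns the direction missed by
      the derivative into the real axis. Below, \<open>C\<close> is
      \<open>(K + \<i> H) / 2\<close>.\<close>
    define C where "C = mat (cnj \<omega>) ** (A - mat z0)"
    define C' where "C' = conj_transpose C"
    have Cv: "C *v v = cnj \<omega> *s (A *v v - z0 *s v)" for v
      by (simp add: C_def mat_complex_mult_vec matrix_vector_mult_diff_rdistrib
          flip: matrix_vector_mul_assoc)
    note CC' = herm_conj_transpose_swap[of _ C, folded C'_def]
    have C'v: "C' *v v = \<omega> *s (conj_transpose A *v v - cnj z0 *s v)" for v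
    proof -
      have "herm x (C' *v v) = herm x (\<omega> *s (conj_transpose A *v v - cnj z0 *s v))" for x
        by (simp add: CC' Cv herm_linear herm_conj_transpose_swap herm_commute[of x v])
      then have "herm x (C' *v v - \<omega> *s (conj_transpose A *v v - cnj z0 *s v)) = 0" for x
        by (simp add: herm_diff_right)
      then show ?thesis by (metis herm_self_eq_0_iff eq_iff_diff_eq_0)
    qed
    define K where "K = C + C'"
    define H where "H = mat (- \<i>) ** (C - C')"
    have Kv: "K *v v = C *v v + C' *v v" for v
      by (simp add: K_def matrix_vector_mult_add_rdistrib)
    have Hv: "H *v v = (- \<i>) *s (C *v v - C' *v v)" for v
      by (simp add: H_def mat_complex_mult_vec matrix_vector_mult_diff_rdistrib
          flip: matrix_vector_mul_assoc)
    have K: "self_adjoint K" and H: "self_adjoint H"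
      unfolding self_adjoint_def Kv Hv C'_def
      by (simp_all add: herm_linear herm_conj_transpose algebra_simps)
    define f where "f x = cnj \<omega> * (herm x (A *v x) - z0)" for x
    have Cf: "herm x (C *v x) = f x" if "herm x x = 1" for x
      using that by (simp add: Cv f_def herm_linear algebra_simps)
    have Kf: "herm x (K *v x) = of_real (2 * Re (f x))"
      and Hf: "herm x (H *v x) = of_real (2 * Im (f x))" if "herm x x = 1" for x
      using Cf[OF that] by (simp_all add: Kv Hv herm_linear CC' complex_eq_iff)
    have f0: "f x0 = 0" by (simp add: f_def z0_def)
    have f_eq: "herm x (A *v x) = herm y (A *v y)"
      if "herm x x = 1" "herm y y = 1" "herm x (K *v x) = herm y (K *v y)"
        "herm x (H *v x) = herm y (H *v y)" for x y
    proof -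
      have "f x = f y" using that by (simp add: Kf Hf complex_eq_iff)
      then show ?thesis using \<omega>0 by (simp add: f_def)
    qed
    have Kx0: "K *v x0 = 0"
    proof -
      \<comment> \<open>The rotated derivative has no real part, so \<open>K *v x0\<close> is
        orthogonal to every \<open>y\<close>, in particular to itself.\<close>
      have "Re (herm y (K *v x0)) = Re (cnj \<omega> * T y)" for y
        by (simp add: Kv herm_linear CC' T_def Cv algebra_simps)
      then have "Re (herm (K *v x0) (K *v x0)) = 0" using \<omega>(2) by simp
      then show ?thesis by (simp add: herm_self)
    qed
    have Hx0: "herm x0 (H *v x0) = 0" using Hf[OF x01] f0 by simp
    have ker: "w = 0" if "K *v w = 0" "H *v w = 0" for w
    proof (rule ccontr)
      assume w: "w \<noteq> 0"
      \<comment> \<open>A common null vector of \<open>K\<close> and \<open>H\<close> would be a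
        common eigenvector of \<open>A\<close> and its adjoint.\<close>
      have "C *v w = 0" "C' *v w = 0"
        using that unfolding Kv Hv by (simp_all add: vec_eq_iff)
      then have "A *v w = z0 *s w" "conj_transpose A *v w = cnj z0 *s w"
        using \<omega>0 unfolding Cv C'v by (simp_all add: vec_eq_iff)
      then show False
        using unitarily_reducible_if_common_eigenvector[OF _ w] irr by auto
    qed
    show ?thesis
    proof (cases "\<exists>x\<in>unit_sphere. herm x (A *v x) = z0 \<and> (\<forall>\<phi>. norm \<phi> = 1 \<longrightarrow> x \<noteq> \<phi> *s x0)")
      case False
      then show ?thesis using fov_open_at_unique_preimage[OF e, of A z0 x0] unfolding z0_def by blast
    next
      case True
      then obtain x where x: "herm x x = 1" "herm x (A *v x) = z0"
        "\<And>\<phi>. norm \<phi> = 1 \<Longrightarrow> x \<noteq> \<phi> *s x0" by (auto simp: unit_sphere_def)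
      have "f x = 0" using x(2) by (simp add: f_def)
      then have xK: "herm x (K *v x) = 0" and xH: "herm x (H *v x) = 0"
        using Kf[OF x(1)] Hf[OF x(1)] by simp_all
      obtain y0 m0 where y0: "herm x0 y0 = 0" "herm y0 (H *v x0) = of_real m0" "m0 > 0"
        "Re (herm y0 (K *v y0)) < 0 \<or> Re (herm y0 (K *v y0)) = 0 \<and> (\<forall>x. 0 \<le> Re (herm x (K *v x)))"
        using exists_direction_below[OF K H x01 Kx0 Hx0 ker x(1) xK xH x(3)] by blast
      \<comment> \<open>The opposite sign is obtained by replacing \<open>K\<close> with
        \<open>- K\<close>.\<close>
      obtain y1 m1 where y1: "herm x0 y1 = 0" "herm y1 (H *v x0) = of_real m1" "m1 > 0"
        "Re (herm y1 ((- K) *v y1)) < 0 \<or>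
         Re (herm y1 ((- K) *v y1)) = 0 \<and> (\<forall>x. 0 \<le> Re (herm x ((- K) *v x)))"
        by (rule exists_direction_below[OF self_adjoint_uminus[OF K] H x01 _ Hx0 _ x(1) _ xH x(3)])
          (use Kx0 xK ker in \<open>auto simp: matrix_uminus_mult_vec herm_uminus\<close>)
      have "0 < Re (herm y1 (K *v y1)) \<or>
        Re (herm y1 (K *v y1)) = 0 \<and> (\<forall>x. Re (herm x (K *v x)) \<le> 0)"
        using y1(4) by (auto simp: matrix_uminus_mult_vec herm_uminus)
      from joint_form_open_at[OF K H x01 Kx0 Hx0 y0(1-3) y1(1-3) y0(4) this e]
      obtain d where d: "0 < d" "\<And>x'. norm (herm x' (K *v x')) < d \<Longrightarrow> norm (herm x' (H *v x')) < d \<Longrightarrow>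
        \<exists>x. herm x x = 1 \<and> dist x x0 < e \<and>
          herm x (K *v x) = herm x' (K *v x') \<and> herm x (H *v x) = herm x' (H *v x')"
        by blast
      have "\<exists>x\<in>unit_sphere. dist x x0 < e \<and> herm x (A *v x) = herm x' (A *v x')"
        if x': "x' \<in> unit_sphere" "dist (herm x' (A *v x')) z0 < d / 2" for x'
      proof -
        have x'1: "herm x' x' = 1" using x'(1) by (simp add: unit_sphere_def)
        \<comment> \<open>The forms of \<open>K\<close> and \<open>H\<close> are twice the real and
          imaginary parts of \<open>f\<close>, hence the halved radius.\<close>
        have "norm (f x') < d / 2" using x'(2) \<omega>(1) by (simp add: f_def norm_mult dist_norm)
        then have "\<bar>Re (f x')\<bar> < d / 2" "\<bar>Im (f x')\<bar> < d / 2"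
          using abs_Re_le_cmod[of "f x'"] abs_Im_le_cmod[of "f x'"] by linarith+
        then have "norm (herm x' (K *v x')) < d" "norm (herm x' (H *v x')) < d"
          unfolding Kf[OF x'1] Hf[OF x'1] norm_of_real by simp_all
        from d(2)[OF this] obtain x where x: "herm x x = 1" "dist x x0 < e"
          "herm x (K *v x) = herm x' (K *v x')" "herm x (H *v x) = herm x' (H *v x')" by blast
        show ?thesis
          using x(1,2) f_eq[OF x(1) x'1 x(3,4)] by (intro bexI[of _ x]) (simp_all add: unit_sphere_def)
      qed
      then show ?thesis using d(1) unfolding z0_def by (meson half_gt_zero)
    qed
  qed
qed

section \<open>Passage to projective space\<close>

lemma proj_metric_small:
  assumes \<rho>: "proj_metric \<rho>" and x0: "x0 \<in> unit_sphere" and e: "0 < e"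
  obtains d where "0 < d"
    "\<And>x. x \<in> unit_sphere \<Longrightarrow> dist x x0 < d \<Longrightarrow> \<rho> (proj_class x0) (proj_class x) < e"
proof -
  interpret M: Metric_space proj_space \<rho> using \<rho> by (simp add: proj_metric_def)
  have "continuous_map (top_of_set unit_sphere) M.mtopology proj_class"
    using \<rho> by (simp add: proj_metric_def quotient_imp_continuous_map)
  from bspec[OF this[unfolded M.continuous_map_to_metric], of x0] obtain U where U: "openin (top_of_set unit_sphere) U" "x0 \<in> U"
    "\<And>y. y \<in> U \<Longrightarrow> proj_class y \<in> M.mball (proj_class x0) e"
    using x0 e by auto
  obtain d where "0 < d" "ball x0 d \<inter> unit_sphere \<subseteq> U"
    using U(1,2) unfolding openin_contains_ball by blast
  then show ?thesis
    using U(3) by (intro that[of d]) (auto simp: dist_commute subset_eq)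
qed

theorem theorem10:
  fixes A :: "complex^3^3"
    and \<rho> :: "(complex^3) set \<Rightarrow> (complex^3) set \<Rightarrow> real"
  assumes "unitarily_irreducible A"
    and "proj_metric \<rho>"
  shows "\<forall>z\<in>field_of_values A. strongly_continuous_at (field_of_values A) dist \<rho> (fov_inv A) z"
  unfolding strongly_continuous_at_def
proof (intro ballI allI impI)
  fix z p and \<epsilon> :: real
  assume p: "p \<in> fov_inv A z" and \<epsilon>: "0 < \<epsilon>"
  obtain x0 where x0: "x0 \<in> unit_sphere" "p = proj_class x0"
    using p by (auto simp: fov_inv_def proj_space_eq)
  have z: "z = herm x0 (A *v x0)" using p x0 by (auto simp: fov_inv_def fov_map_proj_class)
  obtain e where e: "0 < e"
    "\<And>x. x \<in> unit_sphere \<Longrightarrow> dist x x0 < e \<Longrightarrow> \<rho> (proj_class x0) (proj_class x) < \<epsilon>"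
    using proj_metric_small[OF assms(2) x0(1) \<epsilon>] by blast
  \<comment> \<open>Strong continuity fixes the point \<open>p\<close> of the preimage, so openness
    at its representative \<open>x0\<close> is exactly what is called for.\<close>
  obtain d where d: "0 < d" "\<And>x'. x' \<in> unit_sphere \<Longrightarrow> dist (herm x' (A *v x')) z < d \<Longrightarrow>
      \<exists>x\<in>unit_sphere. dist x x0 < e \<and> herm x (A *v x) = herm x' (A *v x')"
    using fov_open_at[OF assms(1) x0(1) e(1)] unfolding z by blast
  have "\<exists>y'\<in>fov_inv A z'. \<rho> p y' < \<epsilon>" if z': "z' \<in> field_of_values A" "dist z z' < d" for z'
  proof -
    obtain x' where "x' \<in> unit_sphere" "z' = herm x' (A *v x')"
      using z'(1) unfolding field_of_values_def by blast
    then obtain x where "x \<in> unit_sphere" "dist x x0 < e" "herm x (A *v x) = z'"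
      using d(2)[of x'] z'(2) by (auto simp: dist_commute)
    then show ?thesis using e(2) x0(2)
      by (intro bexI[of _ "proj_class x"])
        (auto simp: fov_inv_def proj_space_eq fov_map_proj_class)
  qed
  then show "\<exists>\<delta>>0. \<forall>z'\<in>field_of_values A. dist z z' < \<delta> \<longrightarrow> (\<exists>y'\<in>fov_inv A z'. \<rho> p y' < \<epsilon>)"
    using d(1) by blast
qed

end
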